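(* Let $M = \langle 6, 9, 20\rangle$ be the McNugget monoid. Each $x \in M$ with $x \ge 92$ satisfies $\Delta(x + 20) = \Delta(x)$. Moreover, for each $x \in M$ with $x \geq 92$, writing $x = 20q + r$ with $q, r$ nonnegative integers and $r < 20$, \[ \Delta(x) = \begin{cases} \{1\} & \text{if } r \in \{3, 8, 14, 17\}, \\ \{1, 2\} & \text{if } r \in \{2, 5, 10, 11, 16, 19\}, \\ \{1, 3\} & \text{if } r \in \{1, 4, 7, 12, 13, 18\}, \\ \{1, 4\} & \text{if } r \in \{0, 6, 9, 15\}. \end{cases} \] Hence $\Delta(M) = \{1, 2, 3, 4\}$.
   Context: The McNugget monoid is $M = \langle 6, 9, 20 \rangle = \{6a + 9b + 20c : a, b, c \in \mathbb{N}_0\}$, a monoid under addition, where $\mathbb{N}_0$ is the set of nonnegative integers. For $x \in M$, the set of factorizations of $x$ is $\mathsf{Z}(x) = \{(a,b,c) \in \mathbb{N}_0^3 : 6a + 9b + 20c = x\}$, the length of a factorization $(a,b,c)$ is $a + b + c$, and the set of lengths of $x$ is $\mathcal{L}(x) = \{a + b + c : (a,b,c) \in \mathsf{Z}(x)\}$, which is finite and nonempty. Writing $\mathcal{L}(x) = \{m_1, \ldots, m_t\}$ with $m_1 < m_2 < \cdots < m_t$, the delta set of $x$ is $\Delta(x) = \{m_i - m_{i-1} : 2 \le i \le t\}$ (empty if $t = 1$), and the delta set of $M$ is $\Delta(M) = \bigcup_{x \in M} \Delta(x)$. *)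

theory Defs
  imports Main
begin

definition McNugget :: "nat set" where
  "McNugget = {6 * a + 9 * b + 20 * c | a b c. True}"

definition factorizations :: "nat \<Rightarrow> (nat \<times> nat \<times> nat) set" where
  "factorizations x = {(a, b, c). 6 * a + 9 * b + 20 * c = x}"

definition fact_length :: "nat \<times> nat \<times> nat \<Rightarrow> nat" where
  "fact_length = (\<lambda>(a, b, c). a + b + c)"

definition length_set :: "nat \<Rightarrow> nat set" where
  "length_set x = fact_length ` factorizations x"

text \<open>Finiteness of \<open>length_set x\<close> is what makes \<open>sorted_list_of_set\<close> in \<open>delta_set\<close>
  below enumerate it; on an infinite set that function would return the empty list.\<close>

lemma finite_length_set: "finite (length_set x)"
proof (rule finite_subset)
  show "length_set x \<subseteq> {..x}"
    by (auto simp: length_set_def fact_length_def factorizations_def)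
qed simp

lemma length_set_nonempty: "x \<in> McNugget \<Longrightarrow> length_set x \<noteq> {}"
  by (auto simp: McNugget_def length_set_def factorizations_def)

text \<open>The list \<open>m\<close> is the increasing enumeration of the set of lengths, indexed from 0.
  It is strictly increasing, so the subtraction on natural numbers does not truncate.\<close>

definition delta_set :: "nat \<Rightarrow> nat set" where
  "delta_set x = (let m = sorted_list_of_set (length_set x)
                  in {m ! Suc i - m ! i | i. Suc i < length m})"

definition delta_set_monoid :: "nat set" where
  "delta_set_monoid = (\<Union>x\<in>McNugget. delta_set x)"

end

theory Submission
  imports Defs
begin

text \<open>The trades \<open>(3, 0, 0) \<rightarrow> (0, 2, 0)\<close> and \<open>(0, 12, 0) \<rightarrow> (8, 0, 3)\<close> lower the length of a
  factorization by exactly 1.  So a gap of size at least 2 can only lie directly below the length of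
  a factorization \<open>(a, b, c)\<close> with \<open>a \<le> 2\<close> and \<open>b \<le> 11\<close>.  The factorizations of the same element
  that are shorter by \<open>j\<close> are the \<open>(a + 11 k - 3 j, b + 2 j - 14 k, c + 3 k)\<close> with \<open>k\<close> an integer, and
  for such \<open>a\<close> and \<open>b\<close> only \<open>k = 1\<close> is possible; hence the size of the gap depends on \<open>a\<close> and \<open>b\<close>
  alone: \<open>b \<in> {10, 11}\<close> gives 2, \<open>b \<in> {8, 9}\<close> gives 3, and \<open>b \<in> {6, 7}\<close> with \<open>a \<ge> 1\<close> gives 4.
  The residues of \<open>6 a + 9 b\<close> modulo 20 are the ones in the theorem.\<close>

section \<open>Gaps in a finite set of naturals\<close>

lemma successive_elements_sorted_list_of_set:
  fixes A :: "nat set"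
  assumes "finite A"
  defines "xs \<equiv> sorted_list_of_set A"
  shows "d \<in> {xs ! Suc i - xs ! i | i. Suc i < length xs} \<longleftrightarrow>
    d > 0 \<and> (\<exists>m\<in>A. m + d \<in> A \<and> (\<forall>e. 0 < e \<and> e < d \<longrightarrow> m + e \<notin> A))"
    (is "?L \<longleftrightarrow> ?R")
proof -
  have A: "set xs = A" using assms by simp
  \<comment> \<open>Index order matches element order, so an element strictly between
    \<open>xs ! i\<close> and \<open>xs ! Suc i\<close> would need an index strictly between
    \<open>i\<close> and \<open>Suc i\<close>.\<close>
  have mono: "xs ! i < xs ! j \<longleftrightarrow> i < j" if "i < length xs" "j < length xs" for i j
    using that strict_sorted_list_of_set[of A]
    by (metis xs_def linorder_neqE_nat not_less_iff_gr_or_eq sorted_wrt_nth_less)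
  show ?thesis
  proof
    assume ?L
    then obtain i where i: "Suc i < length xs" and d: "d = xs ! Suc i - xs ! i" by auto
    have less: "xs ! i < xs ! Suc i" using mono i by simp
    have "xs ! i + e \<notin> A" if "0 < e" "e < d" for e
    proof
      assume "xs ! i + e \<in> A"
      then obtain j where "j < length xs" "xs ! j = xs ! i + e"
        using A by (metis in_set_conv_nth)
      moreover from this have "i < j" "j < Suc i"
        using mono[of i j] mono[of j "Suc i"] that d i by auto
      ultimately show False by simp
    qed
    moreover have "xs ! i \<in> A" "xs ! i + d \<in> A" "d > 0"
      using A i d less by (auto intro: nth_mem)
    ultimately show ?R by blast
  next
    assume ?R
    then obtain m where m: "m \<in> A" "m + d \<in> A" "d > 0"
      and gap: "\<And>e. 0 < e \<Longrightarrow> e < d \<Longrightarrow> m + e \<notin> A" by blast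
    obtain i where i: "i < length xs" "xs ! i = m" using A m by (metis in_set_conv_nth)
    obtain j where j: "j < length xs" "xs ! j = m + d" using A m by (metis in_set_conv_nth)
    have "i < j" using mono[of i j] i j m by simp
    have "j = Suc i"
    proof (rule ccontr)
      assume "j \<noteq> Suc i"
      then have "Suc i < j" using \<open>i < j\<close> by simp
      then have k: "Suc i < length xs" "xs ! i < xs ! Suc i" "xs ! Suc i < xs ! j"
        using mono[of i "Suc i"] mono[of "Suc i" j] i(1) j(1) by auto
      then have "xs ! Suc i = m + (xs ! Suc i - m)" "xs ! Suc i \<in> A" using i A by auto
      moreover have "0 < xs ! Suc i - m" "xs ! Suc i - m < d" using k i(2) j(2) by linarith+
      ultimately show False using gap by metis
    qed
    then show ?L using i j by (auto intro!: exI[of _ i])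
  qed
qed

lemma mem_delta_set_iff:
  "d \<in> delta_set x \<longleftrightarrow> d > 0 \<and>
    (\<exists>m\<in>length_set x. m + d \<in> length_set x \<and> (\<forall>e. 0 < e \<and> e < d \<longrightarrow> m + e \<notin> length_set x))"
  unfolding delta_set_def Let_def
  by (rule successive_elements_sorted_list_of_set) (rule finite_length_set)

section \<open>Shorter factorizations of the same element\<close>

lemma mem_length_set_iff:
  "l \<in> length_set x \<longleftrightarrow> (\<exists>a b c. 6 * a + 9 * b + 20 * c = x \<and> a + b + c = l)"
  by (auto simp: length_set_def factorizations_def fact_length_def image_iff)

text \<open>The last two hypotheses make \<open>(a + 11 - 3 j, b + 2 j - 14, c + 3)\<close>, the
  case \<open>k = 1\<close> of the family, nonnegative; this is the factorization of length
  \<open>m\<close>.\<close>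

lemma length_set_shorter:
  assumes "6 * a + 9 * b + 20 * c = x" "m + j = a + b + c" "14 \<le> b + 2 * j" "3 * j \<le> 11 + a"
  shows "m \<in> length_set x"
proof -
  obtain p where p: "11 + a = 3 * j + p" using assms(4) le_Suc_ex by blast
  obtain q where q: "b + 2 * j = 14 + q" using assms(3) le_Suc_ex by blast
  have "6 * (11 + a) + 9 * (b + 2 * j) = 6 * (3 * j + p) + 9 * (14 + q)"
    by (simp only: p q)
  then have "6 * p + 9 * q + 20 * (c + 3) = x"
    using assms(1) by simp
  moreover have "p + q + (c + 3) = m"
    using assms(2) p q by simp
  ultimately show ?thesis unfolding mem_length_set_iff by blast
qed

text \<open>Partial converse of \<open>length_set_shorter\<close>: with \<open>a\<close> and
  \<open>b\<close> this small, a factorization of length \<open>m\<close> must be the one with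
  \<open>k = 1\<close>, and its coordinates are nonnegative.\<close>

lemma length_set_shorter_bounds:
  assumes "6 * a + 9 * b + 20 * c = x" "m + j = a + b + c" "m \<in> length_set x"
    and "a \<le> 2" "b \<le> 11" "j > 0"
  shows "14 \<le> b + 2 * j \<and> 3 * j \<le> 11 + a"
proof -
  obtain a' b' c' where f: "6 * a' + 9 * b' + 20 * c' = x" "a' + b' + c' = m"
    using assms(3) mem_length_set_iff by auto
  define A B C A' B' C' J where "A = int a" "B = int b" "C = int c"
    "A' = int a'" "B' = int b'" "C' = int c'" "J = int j"
  note ints = this
  have nonneg: "A' \<ge> 0" "B' \<ge> 0" "A \<le> 2" "B \<le> 11" "J > 0"
    using assms(4-6) by (simp_all add: ints)
  have sum: "A' + B' + C' + J = A + B + C"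
    using f(2) assms(2) unfolding ints by linarith
  have "int (6 * a' + 9 * b' + 20 * c') = int (6 * a + 9 * b + 20 * c)"
    using f(1) assms(1) by simp
  then have "6 * A' + 9 * B' + 20 * C' = 6 * A + 9 * B + 20 * C"
    by (simp add: ints)
  with sum have eq: "3 * B' + 14 * C' = 3 * B + 14 * C + 6 * J" by linarith
  \<comment> \<open>This is \<open>(C' - C) / 3\<close> written without division: \<open>eq\<close>
    says \<open>3 (B' - B - 2 J) = -14 (C' - C)\<close>, so
    \<open>3 k = (15 - 14) (C' - C)\<close>.\<close>
  define k where "k = 5 * (C' - C) + B' - B - 2 * J"
  have k: "C' = C + 3 * k" using eq by (simp add: k_def algebra_simps)
  have B': "B' = B + 2 * J - 14 * k" using eq k by linarith
  have A': "A' = A + 11 * k - 3 * J" using sum k B' by linarith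
  \<comment> \<open>Otherwise \<open>A' \<le> A - 3 J \<le> 2 - 3 < 0\<close>.\<close>
  have "k > 0" using A' nonneg by linarith
  \<comment> \<open>The combination \<open>2 A' + 3 B' = 2 A + 3 B - 20 k\<close> eliminates
    \<open>J\<close>, and \<open>2 A + 3 B \<le> 37\<close>.\<close>
  moreover have "k < 2" using A' B' nonneg by linarith
  ultimately have "k = 1" by simp
  then have "14 \<le> B + 2 * J" "3 * J \<le> 11 + A" using A' B' nonneg by linarith+
  then show ?thesis unfolding ints by linarith
qed

section \<open>Gap sizes in a set of lengths\<close>

lemma length_set_drop_one:
  assumes "6 * a + 9 * b + 20 * c = x" "a \<ge> 3 \<or> b \<ge> 12"
  shows "a + b + c - 1 \<in> length_set x"
  using assms(2)
proof
  assume "a \<ge> 3"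
  then obtain p where p: "a = 3 + p" using le_Suc_ex by blast
  then have "6 * p + 9 * (b + 2) + 20 * c = x \<and> p + (b + 2) + c = a + b + c - 1"
    using assms(1) by simp
  then show ?thesis unfolding mem_length_set_iff by blast
next
  assume "b \<ge> 12"
  \<comment> \<open>The trade of twelve nines is the case \<open>j = k = 1\<close> composed with
    nothing else: \<open>(a + 8, b - 12, c + 3)\<close>.\<close>
  then show ?thesis using length_set_shorter[OF assms(1), of _ 1] by simp
qed

lemma one_mem_delta_set:
  assumes "6 * a + 9 * b + 20 * c = x" "a \<ge> 3 \<or> b \<ge> 12"
  shows "1 \<in> delta_set x"
proof -
  have "a + b + c - 1 + 1 \<in> length_set x"
    unfolding mem_length_set_iff using assms(1)
  proof (intro exI conjI)
    show "a + b + c = a + b + c - 1 + 1" using assms(2) by linarith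
  qed
  then show ?thesis
    using length_set_drop_one[OF assms] by (auto simp: mem_delta_set_iff)
qed

text \<open>A gap \<open>d\<close> is the least \<open>j > 0\<close> satisfying both bounds of
  \<open>length_set_shorter\<close>. The bound \<open>3 * j \<le> 11 + a\<close> passes to smaller
  \<open>j\<close>, so leastness depends on \<open>14 \<le> b + 2 * j\<close> alone, whose right
  side grows by 2 and is therefore 14 or 15 at \<open>j = d\<close>.\<close>

lemma gap_mem_delta_set_iff:
  assumes "d \<ge> 2"
  shows "d \<in> delta_set x \<longleftrightarrow> (\<exists>a b c. 6 * a + 9 * b + 20 * c = x \<and> a \<le> 2 \<and>
    3 * d \<le> 11 + a \<and> 14 \<le> b + 2 * d \<and> b + 2 * d \<le> 15)"
    (is "_ \<longleftrightarrow> ?R")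
proof
  assume "d \<in> delta_set x"
  then obtain m where m: "m \<in> length_set x" "m + d \<in> length_set x"
    and gap: "\<And>e. 0 < e \<Longrightarrow> e < d \<Longrightarrow> m + e \<notin> length_set x"
    by (auto simp: mem_delta_set_iff)
  then obtain a b c where f: "6 * a + 9 * b + 20 * c = x" "m + d = a + b + c"
    by (auto simp: mem_length_set_iff)
  have "m + (d - 1) = a + b + c - 1" using f(2) assms by linarith
  then have "a + b + c - 1 \<notin> length_set x"
    using gap[of "d - 1"] assms by simp
  then have ab: "a \<le> 2" "b \<le> 11" using length_set_drop_one[OF f(1)] by linarith+
  have bounds: "14 \<le> b + 2 * d" "3 * d \<le> 11 + a"
    using length_set_shorter_bounds[OF f m(1) ab] assms by auto
  have "b + 2 * d \<le> 15"
  proof (rule ccontr)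
    assume "\<not> b + 2 * d \<le> 15"
    \<comment> \<open>Now \<open>d - 1\<close> satisfies both bounds as well, which puts a length
      inside the gap.\<close>
    then have "m + 1 \<in> length_set x"
      using length_set_shorter[OF f(1), of "m + 1" "d - 1"] f(2) bounds assms by simp
    then show False using gap[of 1] assms by auto
  qed
  then show ?R using f ab bounds by blast
next
  assume ?R
  then obtain a b c where f: "6 * a + 9 * b + 20 * c = x" "a \<le> 2"
    "3 * d \<le> 11 + a" "14 \<le> b + 2 * d" "b + 2 * d \<le> 15" by blast
  define m where "m = a + b + c - d"
  have md: "m + d = a + b + c" using f by (auto simp: m_def)
  have "m \<in> length_set x" using length_set_shorter[OF f(1) md] f by simp
  moreover have "m + d \<in> length_set x" using f(1) md by (auto simp: mem_length_set_iff)
  moreover have "m + e \<notin> length_set x" if "0 < e" "e < d" for e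
  proof
    assume "m + e \<in> length_set x"
    \<comment> \<open>The bound \<open>b \<le> 11\<close> needed here comes from
      \<open>b + 2 * d \<le> 15\<close> and \<open>d \<ge> 2\<close>.\<close>
    then have "14 \<le> b + 2 * (d - e)"
      using length_set_shorter_bounds[OF f(1), of "m + e" "d - e"] md that f assms by auto
    then show False using f that by auto
  qed
  ultimately show "d \<in> delta_set x" using assms by (auto simp: mem_delta_set_iff)
qed

lemma delta_set_subset: "delta_set x \<subseteq> {1, 2, 3, 4}"
proof
  fix d assume d: "d \<in> delta_set x"
  then have "d > 0" by (simp add: mem_delta_set_iff)
  \<comment> \<open>Here \<open>3 * d \<le> 11 + a \<le> 13\<close>.\<close>
  moreover have "d \<le> 4" if "d \<ge> 2"
    using d gap_mem_delta_set_iff[OF that] by auto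
  ultimately show "d \<in> {1, 2, 3, 4}" by fastforce
qed

section \<open>Large elements: residues modulo 20 and gaps of size one\<close>

lemma ex_add_mult_eq_iff:
  fixes x k n :: nat
  assumes "k < x + n"
  shows "(\<exists>c. k + n * c = x) \<longleftrightarrow> x mod n = k mod n"
proof
  assume eq: "x mod n = k mod n"
  \<comment> \<open>A number congruent to \<open>x\<close> and above it is at least
    \<open>x + n\<close>.\<close>
  have "k \<le> x"
  proof (rule ccontr)
    assume "\<not> k \<le> x"
    then have "n dvd k - x" "0 < k - x" using eq mod_eq_dvd_iff_nat[of x k n] by auto
    then show False using dvd_imp_le[of n "k - x"] assms by simp
  qed
  then have "n dvd x - k" "x = k + (x - k)" using eq by (auto simp: mod_eq_dvd_iff_nat)
  then show "\<exists>c. k + n * c = x" by (metis dvd_def)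
qed auto

text \<open>This is where 92 comes from: the largest \<open>6 * a + 9 * b\<close> that occurs is
  \<open>6 * 2 + 9 * 11 = 111\<close>, and \<open>ex_add_mult_eq_iff\<close> asks for
  \<open>111 < x + 20\<close>.\<close>

lemma two_mem_delta_set_iff:
  assumes "x \<ge> 92"
  shows "2 \<in> delta_set x \<longleftrightarrow> x mod 20 \<in> {2, 5, 10, 11, 16, 19}"
proof -
  have "2 \<in> delta_set x \<longleftrightarrow> (\<exists>a b c. 6 * a + 9 * b + 20 * c = x \<and>
      (a = 0 \<or> a = 1 \<or> a = 2) \<and> (b = 10 \<or> b = 11))"
    by (subst gap_mem_delta_set_iff, simp) (intro ex_cong1, auto)
  also have "\<dots> \<longleftrightarrow> x mod 20 \<in> {2, 5, 10, 11, 16, 19}"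
    using assms
    by (auto simp: conj_disj_distribL conj_disj_distribR ex_disj_distrib ex_add_mult_eq_iff)
  finally show ?thesis .
qed

lemma three_mem_delta_set_iff:
  assumes "x \<ge> 92"
  shows "3 \<in> delta_set x \<longleftrightarrow> x mod 20 \<in> {1, 4, 7, 12, 13, 18}"
proof -
  have "3 \<in> delta_set x \<longleftrightarrow> (\<exists>a b c. 6 * a + 9 * b + 20 * c = x \<and>
      (a = 0 \<or> a = 1 \<or> a = 2) \<and> (b = 8 \<or> b = 9))"
    by (subst gap_mem_delta_set_iff, simp) (intro ex_cong1, auto)
  also have "\<dots> \<longleftrightarrow> x mod 20 \<in> {1, 4, 7, 12, 13, 18}"
    using assms
    by (auto simp: conj_disj_distribL conj_disj_distribR ex_disj_distrib ex_add_mult_eq_iff)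
  finally show ?thesis .
qed

lemma four_mem_delta_set_iff:
  assumes "x \<ge> 92"
  shows "4 \<in> delta_set x \<longleftrightarrow> x mod 20 \<in> {0, 6, 9, 15}"
proof -
  have "4 \<in> delta_set x \<longleftrightarrow> (\<exists>a b c. 6 * a + 9 * b + 20 * c = x \<and>
      (a = 1 \<or> a = 2) \<and> (b = 6 \<or> b = 7))"
    by (subst gap_mem_delta_set_iff, simp) (intro ex_cong1, auto)
  also have "\<dots> \<longleftrightarrow> x mod 20 \<in> {0, 6, 9, 15}"
    using assms
    by (auto simp: conj_disj_distribL conj_disj_distribR ex_disj_distrib ex_add_mult_eq_iff)
  finally show ?thesis .
qed

text \<open>Three sixes allow the trade for two nines, which yields the gap 1; the lemma also shows
  that every \<open>x \<ge> 62\<close> lies in the monoid.\<close>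

lemma ex_factorization_three_sixes:
  fixes x :: nat
  assumes "x \<ge> 62"
  shows "\<exists>a b c. 6 * a + 9 * b + 20 * c = x \<and> a \<ge> 3"
proof -
  \<comment> \<open>Since \<open>-20\<close> is 1 modulo 3, adding \<open>c\<close> does the work of subtracting \<open>20 c\<close>.\<close>
  have "\<exists>c\<le>2. \<exists>z. x + c = 3 * z" by presburger
  then obtain c z where c: "c \<le> 2" "x + c = 3 * z" by blast
  \<comment> \<open>From \<open>x = 3 z - c = 3 (z - 7 c) + 20 c\<close>.\<close>
  define y where "y = z - 7 * c"
  \<comment> \<open>The bound holds because \<open>62 - 2 * 20 = 22 > 3 * 7\<close>. It leaves three
    sixes even when \<open>y\<close> is odd and a nine is split off.\<close>
  have y: "x = 3 * y + 20 * c" "y \<ge> 8" using assms c by (auto simp: y_def)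
  show ?thesis
  proof (cases "even y")
    case True
    then obtain a where "y = 2 * a" by blast
    then show ?thesis using y by (intro exI[of _ a] exI[of _ 0] exI[of _ c]) simp
  next
    case False
    then obtain a where a: "y = 2 * a + 1" by (blast elim: oddE)
    with y have "a \<ge> 4" by simp
    then obtain p where "a = 4 + p" using le_Suc_ex by blast
    then show ?thesis using y a by (intro exI[of _ "p + 3"] exI[of _ 1] exI[of _ c]) simp
  qed
qed

theorem theorem4p3:
  shows "(\<forall>x\<in>McNugget. x \<ge> 92 \<longrightarrow> delta_set (x + 20) = delta_set x) \<and>
    (\<forall>x\<in>McNugget. x \<ge> 92 \<longrightarrow>
      (\<forall>q r :: nat. x = 20 * q + r \<and> r < 20 \<longrightarrow>
        (r \<in> {3, 8, 14, 17} \<longrightarrow> delta_set x = {1}) \<and>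
        (r \<in> {2, 5, 10, 11, 16, 19} \<longrightarrow> delta_set x = {1, 2}) \<and>
        (r \<in> {1, 4, 7, 12, 13, 18} \<longrightarrow> delta_set x = {1, 3}) \<and>
        (r \<in> {0, 6, 9, 15} \<longrightarrow> delta_set x = {1, 4}))) \<and>
    delta_set_monoid = {1, 2, 3, 4}"
proof -
  have delta: "delta_set x = {1} \<union> (if x mod 20 \<in> {2, 5, 10, 11, 16, 19} then {2} else {})
      \<union> (if x mod 20 \<in> {1, 4, 7, 12, 13, 18} then {3} else {})
      \<union> (if x mod 20 \<in> {0, 6, 9, 15} then {4} else {})"
    if "x \<ge> 92" for x
  proof -
    have "1 \<in> delta_set x"
      using ex_factorization_three_sixes[of x] one_mem_delta_set that by fastforce
    then have "delta_set x = {1} \<union> (if 2 \<in> delta_set x then {2} else {})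
      \<union> (if 3 \<in> delta_set x then {3} else {}) \<union> (if 4 \<in> delta_set x then {4} else {})"
      using delta_set_subset[of x] by auto
    then show ?thesis
      by (simp only: two_mem_delta_set_iff[OF that] three_mem_delta_set_iff[OF that]
          four_mem_delta_set_iff[OF that])
  qed
  have periodic: "delta_set (x + 20) = delta_set x" if "x \<ge> 92" for x
    using that by (simp only: delta trans_le_add1 mod_add_self2)
  have residues: "(r \<in> {3, 8, 14, 17} \<longrightarrow> delta_set x = {1}) \<and>
        (r \<in> {2, 5, 10, 11, 16, 19} \<longrightarrow> delta_set x = {1, 2}) \<and>
        (r \<in> {1, 4, 7, 12, 13, 18} \<longrightarrow> delta_set x = {1, 3}) \<and>
        (r \<in> {0, 6, 9, 15} \<longrightarrow> delta_set x = {1, 4})"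
    if "x \<ge> 92" "x = 20 * q + r" "r < 20" for x q r
  proof -
    have "x mod 20 = r" using that by simp
    with delta[OF that(1)] show ?thesis by auto
  qed
  \<comment> \<open>The residues of 92, 96 and 100 modulo 20 are 12, 16 and 0, which give the gaps
    3, 2 and 4 besides 1.\<close>
  have "{1, 2, 3, 4} \<subseteq> delta_set 92 \<union> delta_set 96 \<union> delta_set 100"
    by (simp add: delta)
  moreover have "x \<in> McNugget" if "x \<ge> 62" for x
    using ex_factorization_three_sixes[OF that] by (auto simp: McNugget_def)
  then have "{92, 96, 100} \<subseteq> McNugget" by simp
  ultimately have "{1, 2, 3, 4} \<subseteq> delta_set_monoid" by (auto simp: delta_set_monoid_def)
  moreover have "delta_set_monoid \<subseteq> {1, 2, 3, 4}"
    unfolding delta_set_monoid_def using delta_set_subset by (rule UN_least)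
  ultimately have "delta_set_monoid = {1, 2, 3, 4}" by (rule subset_antisym[rotated])
  then show ?thesis
  proof (rule conjI[OF _ conjI, rotated 2])
    show "\<forall>x\<in>McNugget. 92 \<le> x \<longrightarrow> delta_set (x + 20) = delta_set x"
      using periodic by blast
  next
    show "\<forall>x\<in>McNugget. 92 \<le> x \<longrightarrow> (\<forall>q r :: nat. x = 20 * q + r \<and> r < 20 \<longrightarrow>
        (r \<in> {3, 8, 14, 17} \<longrightarrow> delta_set x = {1}) \<and>
        (r \<in> {2, 5, 10, 11, 16, 19} \<longrightarrow> delta_set x = {1, 2}) \<and>
        (r \<in> {1, 4, 7, 12, 13, 18} \<longrightarrow> delta_set x = {1, 3}) \<and>
        (r \<in> {0, 6, 9, 15} \<longrightarrow> delta_set x = {1, 4}))"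
      by (intro ballI impI allI, elim conjE) (rule residues)
  qed
qed

end
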